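(* For all integers $m,n$ with $3\le m<n$ there exists an $(n-1)$-dimensional completely entangled subspace $V$ supported in $\mathbb{C}^m\otimes\mathbb{C}^n$ such that $$\mathcal{P}_V=\{\,|e\rangle\otimes|f^*\rangle\in\mathbb{C}^m\otimes\mathbb{C}^n \;:\; |e\rangle\otimes|f\rangle\in V^\perp\,\}$$ does not span $\mathbb{C}^m\otimes\mathbb{C}^n$.
   Context: A subspace $V$ of $\mathbb{C}^m\otimes\mathbb{C}^n$ is a completely entangled subspace (CES) if it contains no nonzero product vector $|e\rangle\otimes|f\rangle$. It is supported in $\mathbb{C}^m\otimes\mathbb{C}^n$ if it is not contained in any $V_1\otimes V_2$ with $V_1\subseteq\mathbb{C}^m$, $V_2\subseteq\mathbb{C}^n$ subspaces of which at least one is proper. $|f^*\rangle$ denotes the entrywise complex conjugate of $|f\rangle$ in the standard basis. *)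

theory Defs
  imports "HOL-Analysis.Analysis"
begin

text \<open>
  The space of $m \times n$ arrays \<open>complex ^ ('m \<times> 'n)\<close> serves as the tensor product of
  \<open>complex ^ 'm\<close> and \<open>complex ^ 'n\<close>. Linear notions are over the complex field: they are
  those of the interpretation \<open>vec\<close> (scaling \<open>*s\<close>), not of the real vector space structure.
\<close>

definition tensor :: "complex ^ 'm \<Rightarrow> complex ^ 'n \<Rightarrow> complex ^ ('m::finite \<times> 'n::finite)"
    (infixr \<open>\<otimes>\<^sub>v\<close> 70)
  where "e \<otimes>\<^sub>v f = (\<chi> p. e $ fst p * f $ snd p)"

definition tensor_space ::
    "(complex ^ 'm) set \<Rightarrow> (complex ^ 'n) set \<Rightarrow> (complex ^ ('m::finite \<times> 'n::finite)) set"
  where "tensor_space V1 V2 = vec.span {e \<otimes>\<^sub>v f | e f. e \<in> V1 \<and> f \<in> V2}"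

definition conj_vec :: "complex ^ 'n \<Rightarrow> complex ^ ('n::finite)"
  where "conj_vec f = (\<chi> j. cnj (f $ j))"

definition herm_inner :: "complex ^ 'k \<Rightarrow> complex ^ ('k::finite) \<Rightarrow> complex"
  where "herm_inner x y = (\<Sum>k\<in>UNIV. cnj (x $ k) * y $ k)"

definition orth_compl :: "(complex ^ 'k) set \<Rightarrow> (complex ^ ('k::finite)) set"
  where "orth_compl V = {y. \<forall>x\<in>V. herm_inner x y = 0}"

definition completely_entangled :: "(complex ^ ('m::finite \<times> 'n::finite)) set \<Rightarrow> bool"
  where "completely_entangled V \<longleftrightarrow>
    vec.subspace V \<and> \<not> (\<exists>e f. e \<otimes>\<^sub>v f \<noteq> 0 \<and> e \<otimes>\<^sub>v f \<in> V)"

definition fully_supported :: "(complex ^ ('m::finite \<times> 'n::finite)) set \<Rightarrow> bool"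
  where "fully_supported V \<longleftrightarrow>
    \<not> (\<exists>V1 V2. vec.subspace V1 \<and> vec.subspace V2 \<and> (V1 \<noteq> UNIV \<or> V2 \<noteq> UNIV) \<and>
        V \<subseteq> tensor_space V1 V2)"

definition partial_conj_products ::
    "(complex ^ ('m::finite \<times> 'n::finite)) set \<Rightarrow> (complex ^ ('m \<times> 'n)) set"
  where "partial_conj_products V = {e \<otimes>\<^sub>v conj_vec f | e f. e \<otimes>\<^sub>v f \<in> orth_compl V}"

end

theory Submission
  imports Defs
begin

text \<open>
  Index rows and columns from 0. On \<open>\<complex>\<^sup>3 \<otimes> \<complex>\<^sup>4\<close> consider the bilinear forms
  \<open>(e, f) \<mapsto> w\<^sub>0 e\<^sub>0 f\<^sub>0 + det (e, w, (f\<^sub>1, f\<^sub>2, f\<^sub>3))\<close> with \<open>w \<in> \<complex>\<^sup>3\<close>. If they all vanish at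
  \<open>(e, f)\<close>, then \<open>w = e\<close> gives \<open>e\<^sub>0\<^sup>2 f\<^sub>0 = 0\<close>, so every product vector annihilated by them
  satisfies \<open>e\<^sub>0 f\<^sub>0 = 0\<close>, a condition that survives conjugation of \<open>f\<close>. It also survives adding
  further forms, so it only remains to add \<open>n - 4\<close> of them such that all rows and columns are
  used and no matrix of rank one arises. Each additional parameter occurs in row 1 and, in a later
  column, in another row; this shift excludes rank one.
\<close>

text \<open>
  Entry \<open>(i, j)\<close> of the \<open>m \<times> n\<close> matrix with parameter \<open>w\<close>. The parameter \<open>w 3\<close> is unused,
  which leaves \<open>n - 1\<close> parameters; \<open>w n\<close> has to be 0.
\<close>

definition ces_entry :: "nat \<Rightarrow> (nat \<Rightarrow> complex) \<Rightarrow> nat \<Rightarrow> nat \<Rightarrow> complex" where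
  "ces_entry m w i j =
    (if j = 0 then (if i = 0 then w 0 else if i = 1 then w 4 else 0)
     else if j = 1 then (if i = 1 then w 2 else if i = 2 then - w 1 else 0)
     else if j = 2 then (if i = 2 then w 0 else if i = 0 then - w 2 else 0)
     else if j = 3 then (if i = 0 then w 1 else if i = 1 then - w 0 else 0)
     else if i = 1 then w (Suc j)
     else if i = (if j \<le> m then j - 1 else 0) then w j else 0)"

text \<open>Row 1 contains every parameter except \<open>w 1\<close> and \<open>w 3\<close>, so
  \<open>e 1 = 0\<close> leaves only \<open>w 1\<close> to treat. If \<open>e 1 \<noteq> 0\<close>,
  a zero entry of row 1 makes its whole column vanish; from column 4 on this turns
  \<open>w (Suc k) = 0\<close> into \<open>w k = 0\<close>, so the parameters die downwards from
  \<open>w n\<close>.\<close>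

lemma ces_entry_product_imp_zero:
  fixes w e f :: "nat \<Rightarrow> complex"
  assumes "3 \<le> m" "m < n" and w3: "w 3 = 0" and wn: "\<And>k. n \<le> k \<Longrightarrow> w k = 0"
    and ef: "\<And>i j. i < m \<Longrightarrow> j < n \<Longrightarrow> e i * f j = ces_entry m w i j"
  shows "w k = 0"
proof -
  note D = ces_entry_def
  have eq: "e 1 * f 0 = w 4" "e 1 * f 1 = w 2" "e 1 * f 2 = 0" "e 1 * f 3 = - w 0"
    "e 0 * f 0 = w 0" "e 0 * f 2 = - w 2" "e 0 * f 3 = w 1" "e 2 * f 1 = - w 1" "e 2 * f 3 = 0"
    using assms(1,2) by (simp_all add: ef D)
  have next_w: "e 1 * f j = w (Suc j)" if "4 \<le> j" "j < n" for j
    using that assms(1,2) by (simp add: ef D)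
  have high: "w j = 0" if "4 \<le> j" for j
  proof (cases "e 1 = 0")
    case True
    then have "w 4 = 0" using eq(1) by simp
    moreover have "w (Suc i) = 0" if "4 \<le> i" for i
      using next_w[OF that] wn[of "Suc i"] True by (cases "i < n") auto
    ultimately show ?thesis
      using that by (metis le_less lessE less_Suc_eq_le)
  next
    case False
    \<comment> \<open>The descent starts at \<open>max n j\<close>: at least \<open>n\<close>, where
      parameters are 0, and at least \<open>j\<close>, so that \<open>j \<ge> n\<close> is covered
      too.\<close>
    have "j \<le> max n j" by simp
    then show ?thesis using that
    proof (induction rule: inc_induct)
      case base
      then show ?case using wn by simp
    next
      case (step k)
      show ?case
      proof (cases "k < n")
        case True
        then have "e 1 * f k = 0" using next_w step by simp
        then have "f k = 0" using False by simp
        \<comment> \<open>The second place of \<open>w k\<close>: in column \<open>k\<close>, off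
          row 1.\<close>
        moreover have "e (if k \<le> m then k - 1 else 0) * f k = w k"
          using True step.prems assms(1,2) by (subst ef) (auto simp: D)
        ultimately show ?thesis by simp
      qed (use wn in simp)
    qed
  qed
  have "w 4 = 0" using high by simp
  have "w 0 = 0 \<and> w 1 = 0 \<and> w 2 = 0"
  proof (cases "e 1 = 0")
    case True
    then have "w 0 = 0" "w 2 = 0" using eq by auto
    \<comment> \<open>\<open>w 1 \<noteq> 0\<close> would make both \<open>f 3\<close> and
      \<open>e 2\<close> nonzero, but their product is entry (2, 3), which is 0.\<close>
    moreover have "w 1 = 0" using eq(7-9) by auto
    ultimately show ?thesis by simp
  next
    case False
    then have "f 0 = 0" "f 2 = 0" using eq \<open>w 4 = 0\<close> by auto
    then have "w 0 = 0" "w 2 = 0" using eq by auto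
    then have "f 1 = 0" using False eq by auto
    then show ?thesis using eq \<open>w 0 = 0\<close> \<open>w 2 = 0\<close> by auto
  qed
  moreover have "k = 0 \<or> k = 1 \<or> k = 2 \<or> k = 3 \<or> 4 \<le> k" by arith
  ultimately show ?thesis using w3 high by auto
qed

text \<open>For the support: \<open>V1\<close> contains all columns of the matrices in
  \<open>V\<close>, so these unit columns force it to be everything. Rows from 3 on are reached
  because column \<open>Suc i\<close>, which exists by \<open>m < n\<close>, carries
  \<open>w (Suc i)\<close> in row \<open>i\<close>.\<close>

lemma ces_entry_unit_column:
  assumes "3 \<le> m" "m < n" "i < m"
  obtains k j where "k < n" "k \<noteq> 3" "j < n"
    "\<And>i'. ces_entry m (\<lambda>l. of_bool (l = k)) i' j = of_bool (i' = i)"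
proof -
  consider "i = 0" | "i = 1" | "i = 2" | "3 \<le> i" by arith
  then show ?thesis
  proof cases
    case 1
    then show ?thesis using assms by (intro that[of 0 0]) (auto simp: ces_entry_def)
  next
    case 2
    then show ?thesis using assms by (intro that[of 2 1]) (auto simp: ces_entry_def)
  next
    case 3
    then show ?thesis using assms by (intro that[of 0 2]) (auto simp: ces_entry_def)
  next
    case 4
    then show ?thesis using assms by (intro that[of "Suc i" "Suc i"]) (auto simp: ces_entry_def)
  qed
qed

text \<open>The counterpart for \<open>V2\<close>. The scalar \<open>c\<close> absorbs the signs of
  the determinant.\<close>

lemma ces_entry_unit_row:
  assumes "3 \<le> m" "m < n" "j < n"
  obtains k i and c :: complex where "k < n" "k \<noteq> 3" "i < m" "c \<noteq> 0"
    "\<And>j'. ces_entry m (\<lambda>l. of_bool (l = k)) i j' = c * of_bool (j' = j)"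
proof -
  consider "j = 0" | "j = 1" | "j = 2" | "j = 3" | "4 \<le> j" by arith
  then show ?thesis
  proof cases
    case 1
    then show ?thesis using assms by (intro that[of 0 0 1]) (auto simp: ces_entry_def)
  next
    case 2
    then show ?thesis using assms by (intro that[of 1 2 "-1"]) (auto simp: ces_entry_def)
  next
    case 3
    then show ?thesis using assms by (intro that[of 0 2 1]) (auto simp: ces_entry_def)
  next
    case 4
    then show ?thesis using assms by (intro that[of 0 1 "-1"]) (auto simp: ces_entry_def)
  next
    case 5
    then show ?thesis using assms
      by (intro that[of j "if j \<le> m then j - 1 else 0" 1]) (auto simp: ces_entry_def)
  qed
qed

text \<open>Extracting a column is linear and sends \<open>e \<otimes>\<^sub>v f\<close> to a
  multiple of \<open>e\<close>.\<close>

lemma tensor_space_column: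
  fixes X :: "complex ^ ('a::finite \<times> 'b::finite)"
  assumes "vec.subspace V1" "X \<in> tensor_space V1 V2"
  shows "(\<chi> i. X $ (i, j)) \<in> V1"
  using assms(2) unfolding tensor_space_def
proof (induction rule: vec.span_induct)
  case base
  have "Vector_Spaces.linear (*s) (*s) (\<lambda>x :: complex ^ ('a \<times> 'b). \<chi> i. x $ (i, j))"
    by unfold_locales (auto simp: vec_eq_iff algebra_simps)
  from vec.linear_subspace_vimage[OF this assms(1)] show ?case
    by (simp add: vimage_def)
next
  case (step x)
  then obtain e f where x: "x = e \<otimes>\<^sub>v f" "e \<in> V1" by auto
  have "(\<chi> i. x $ (i, j)) = f $ j *s e"
    by (simp add: x tensor_def vec_eq_iff)
  then show ?case using x(2) assms(1) by (simp add: vec.subspace_scale)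
qed

lemma tensor_space_row:
  fixes X :: "complex ^ ('a::finite \<times> 'b::finite)"
  assumes "vec.subspace V2" "X \<in> tensor_space V1 V2"
  shows "(\<chi> j. X $ (i, j)) \<in> V2"
  using assms(2) unfolding tensor_space_def
proof (induction rule: vec.span_induct)
  case base
  have "Vector_Spaces.linear (*s) (*s) (\<lambda>x :: complex ^ ('a \<times> 'b). \<chi> j. x $ (i, j))"
    by unfold_locales (auto simp: vec_eq_iff algebra_simps)
  from vec.linear_subspace_vimage[OF this assms(1)] show ?case
    by (simp add: vimage_def)
next
  case (step x)
  then obtain e f where x: "x = e \<otimes>\<^sub>v f" "f \<in> V2" by auto
  have "(\<chi> j. x $ (i, j)) = e $ i *s f"
    by (simp add: x tensor_def vec_eq_iff)
  then show ?case using x(2) assms(1) by (simp add: vec.subspace_scale)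
qed

lemma subspace_eq_UNIV_if_axis:
  fixes V :: "('a::field ^ 'n::finite) set"
  assumes "vec.subspace V" "\<And>i. axis i 1 \<in> V"
  shows "V = UNIV"
proof -
  have "x \<in> V" for x
  proof -
    have "(\<Sum>i\<in>UNIV. x $ i *s axis i 1) \<in> V"
      by (intro vec.subspace_sum vec.subspace_scale assms)
    then show ?thesis by (simp add: basis_expansion)
  qed
  then show ?thesis by auto
qed

theorem mainTheorem6:
  assumes "3 \<le> CARD('m::finite)" and "CARD('m) < CARD('n::finite)"
  shows "\<exists>V :: (complex ^ ('m \<times> 'n)) set.
    completely_entangled V \<and> vec.dim V = CARD('n) - 1 \<and> fully_supported V \<and>
    vec.span (partial_conj_products V) \<noteq> UNIV"
proof -
  define m n where "m = CARD('m)" and "n = CARD('n)"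
  have mn: "3 \<le> m" "m < n" using assms by (auto simp: m_def n_def)
  obtain g :: "'m \<Rightarrow> nat" where g: "bij_betw g UNIV {0..<m}"
    unfolding m_def using ex_bij_betw_finite_nat[OF finite] by blast
  obtain h :: "'n \<Rightarrow> nat" where h: "bij_betw h UNIV {0..<n}"
    unfolding n_def using ex_bij_betw_finite_nat[OF finite] by blast
  define g' h' where "g' = inv g" and "h' = inv h"
  have g'[simp]: "g' (g i) = i" "g i < m" "i' < m \<Longrightarrow> g (g' i') = i'" for i i'
    using g by (auto simp: g'_def bij_betw_def inj_on_def intro!: inv_f_f f_inv_into_f)
  have h'[simp]: "h' (h i) = i" "h i < n" "i' < n \<Longrightarrow> h (h' i') = i'" for i i'
    using h by (auto simp: h'_def bij_betw_def inj_on_def intro!: inv_f_f f_inv_into_f)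
  have [simp]: "g i = g i' \<longleftrightarrow> i = i'" for i i'
    using g by (auto simp: bij_betw_def inj_on_def)
  have [simp]: "h j = h j' \<longleftrightarrow> j = j'" for j j'
    using h by (auto simp: bij_betw_def inj_on_def)
  have h'_eq: "i = h' k \<longleftrightarrow> h i = k" if "k < n" for i k using that by auto

  \<comment> \<open>The default 0 supplies \<open>w n = 0\<close>, which the last entry of row 1
    requires.\<close>
  define param :: "complex ^ 'n \<Rightarrow> nat \<Rightarrow> complex"
    where "param w k = (if k < n then w $ h' k else 0)" for w k
  define A :: "complex ^ 'n \<Rightarrow> complex ^ ('m \<times> 'n)"
    where "A w = (\<chi> p. ces_entry m (param w) (g (fst p)) (h (snd p)))" for w
  \<comment> \<open>Coordinate 3 does not enter the matrix; fixing it makes \<open>A\<close>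
    injective.\<close>
  define W where "W = {w :: complex ^ 'n. w $ h' 3 = 0}"
  define V where "V = A ` W"

  have W: "vec.subspace W"
    by (auto simp: W_def vec.subspace_def)
  have A: "Vector_Spaces.linear (*s) (*s) A"
    by unfold_locales
      (auto simp: A_def vec_eq_iff param_def ces_entry_def algebra_simps)
  have V: "vec.subspace V"
    unfolding V_def using A W by (rule vec.linear_subspace_image)
  have param_axis: "param (axis (h' k) 1) = (\<lambda>l. of_bool (l = k))" if "k < n" for k
    using that by (auto simp: param_def axis_def fun_eq_iff h'_eq)
  have axis_W: "axis (h' k) 1 \<in> W" if "k < n" "k \<noteq> 3" for k
    using that mn by (auto simp: W_def axis_def h'_eq)

  have entangled: "w = 0" if w: "w \<in> W" and ef: "A w = e \<otimes>\<^sub>v f" for w e f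
  proof -
    have "param w k = 0" for k
    proof (rule ces_entry_product_imp_zero[OF mn])
      show "param w 3 = 0" using w by (simp add: param_def W_def)
      show "param w k = 0" if "n \<le> k" for k using that by (simp add: param_def)
      show "e $ g' i * f $ h' j = ces_entry m (param w) i j" if "i < m" "j < n" for i j
        using arg_cong[OF ef, of "\<lambda>X. X $ (g' i, h' j)"] that by (simp add: A_def tensor_def)
    qed
    from this[of "h _"] show ?thesis by (simp add: param_def vec_eq_iff)
  qed
  have CES: "completely_entangled V"
  proof -
    have "A 0 = 0" using A by (rule vec.linear_0)
    then have "x = 0" if "x \<in> V" "x = e \<otimes>\<^sub>v f" for x e f
      using that entangled unfolding V_def by (metis imageE)
    then show ?thesis using V by (auto simp: completely_entangled_def)
  qed

  have dim: "vec.dim V = CARD('n) - 1"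
  proof -
    have "inj_on A W"
      unfolding vec.linear_inj_on_iff_eq_0[OF A W]
    proof (intro ballI impI)
      fix w assume "w \<in> W" "A w = 0"
      \<comment> \<open>The zero matrix is itself a product, so the exclusion of rank one also
        yields injectivity.\<close>
      moreover have "(0 :: complex ^ ('m \<times> 'n)) = 0 \<otimes>\<^sub>v 0" by (simp add: tensor_def vec_eq_iff)
      ultimately show "w = 0" using entangled by metis
    qed
    then have "vec.dim V = vec.dim W"
      unfolding V_def using W by (intro vec.dim_image_eq[OF A]) (simp add: vec.span_eq_iff[THEN iffD2])
    also have "W = {w. \<forall>i. i \<notin> - {h' 3} \<longrightarrow> w $ i = 0}" by (auto simp: W_def)
    also have "vec.dim \<dots> = card (- {h' 3})" by (rule dim_substandard_cart)
    finally show ?thesis by (simp add: Compl_eq_Diff_UNIV card_Diff_singleton)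
  qed

  have supported: "fully_supported V"
    unfolding fully_supported_def
  proof clarify
    fix V1 :: "(complex ^ 'm) set" and V2 :: "(complex ^ 'n) set"
    assume V1: "vec.subspace V1" and V2: "vec.subspace V2"
      and proper: "V1 \<noteq> UNIV \<or> V2 \<noteq> UNIV" and sub: "V \<subseteq> tensor_space V1 V2"
    have mem: "A (axis (h' k) 1) \<in> tensor_space V1 V2" if "k < n" "k \<noteq> 3" for k
      using axis_W[OF that] sub by (auto simp: V_def)
    have "axis i 1 \<in> V1" for i
    proof -
      obtain k j where kj: "k < n" "k \<noteq> 3" "j < n"
        "\<And>i'. ces_entry m (\<lambda>l. of_bool (l = k)) i' j = of_bool (i' = g i)"
        using ces_entry_unit_column[OF mn, of "g i"] by auto
      have "(\<chi> i'. A (axis (h' k) 1) $ (i', h' j)) = axis i 1"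
        using kj by (simp add: A_def param_axis vec_eq_iff, simp add: axis_def)
      with tensor_space_column[OF V1 mem[OF kj(1,2)], of "h' j"] show ?thesis by (simp only:)
    qed
    moreover have "axis j 1 \<in> V2" for j
    proof -
      obtain k i and c :: complex where ki: "k < n" "k \<noteq> 3" "i < m" "c \<noteq> 0"
        "\<And>j'. ces_entry m (\<lambda>l. of_bool (l = k)) i j' = c * of_bool (j' = h j)"
        using ces_entry_unit_row[OF mn, of "h j"] by auto
      have "inverse c *s (\<chi> j'. A (axis (h' k) 1) $ (g' i, j')) = axis j 1"
        using ki by (simp add: A_def param_axis vec_eq_iff, simp add: axis_def)
      moreover have "inverse c *s (\<chi> j'. A (axis (h' k) 1) $ (g' i, j')) \<in> V2"
        by (intro vec.subspace_scale V2 tensor_space_row[OF V2 mem[OF ki(1,2)]])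
      ultimately show ?thesis by (simp only:)
    qed
    ultimately have "V1 = UNIV" "V2 = UNIV"
      using V1 V2 by (auto intro!: subspace_eq_UNIV_if_axis)
    with proper show False by simp
  qed

  \<comment> \<open>A hyperplane that will contain all conjugated products: conjugating
    \<open>f\<close> does not affect whether the (0, 0) entry of a product is 0.\<close>
  define H where "H = {X :: complex ^ ('m \<times> 'n). X $ (g' 0, h' 0) = 0}"
  have "partial_conj_products V \<subseteq> H"
  proof
    fix x assume "x \<in> partial_conj_products V"
    then obtain e f where x: "x = e \<otimes>\<^sub>v conj_vec f" and ef: "e \<otimes>\<^sub>v f \<in> orth_compl V"
      by (auto simp: partial_conj_products_def)
    define E F where "E i = e $ g' i" and "F j = f $ h' j" for i j
    have orth: "(\<Sum>i<m. \<Sum>j<n. cnj (ces_entry m (\<lambda>l. of_bool (l = k)) i j) * (E i * F j)) = 0"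
      if "k < n" "k \<noteq> 3" for k
    proof -
      have "0 = herm_inner (A (axis (h' k) 1)) (e \<otimes>\<^sub>v f)"
        using ef axis_W[OF that] by (auto simp: orth_compl_def V_def)
      also have "\<dots> = (\<Sum>p\<in>UNIV \<times> UNIV. case p of (i, j) \<Rightarrow>
          cnj (ces_entry m (\<lambda>l. of_bool (l = k)) (g i) (h j)) * (E (g i) * F (h j)))"
        using that by (simp add: herm_inner_def A_def param_axis tensor_def E_def F_def split_beta)
      also have "\<dots> = (\<Sum>i\<in>UNIV. \<Sum>j\<in>UNIV.
          cnj (ces_entry m (\<lambda>l. of_bool (l = k)) (g i) (h j)) * (E (g i) * F (h j)))"
        by (simp add: sum.cartesian_product)
      also have "\<dots> = (\<Sum>i<m. \<Sum>j\<in>UNIV.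
          cnj (ces_entry m (\<lambda>l. of_bool (l = k)) i (h j)) * (E i * F (h j)))"
        using g by (intro sum.reindex_bij_betw) (simp add: lessThan_atLeast0)
      also have "\<dots> = (\<Sum>i<m. \<Sum>j<n. cnj (ces_entry m (\<lambda>l. of_bool (l = k)) i j) * (E i * F j))"
        using h by (intro sum.cong refl sum.reindex_bij_betw) (simp add: lessThan_atLeast0)
      finally show ?thesis by simp
    qed
    \<comment> \<open>Parameters 0, 1 and 2 occur only in the upper left 3 by 4 block, so their
      conditions do not depend on \<open>m\<close> and \<open>n\<close>.\<close>
    have restrict: "(\<Sum>i<m. \<Sum>j<n. cnj (ces_entry m (\<lambda>l. of_bool (l = k)) i j) * (E i * F j)) =
       (\<Sum>i<3. \<Sum>j<4. cnj (ces_entry m (\<lambda>l. of_bool (l = k)) i j) * (E i * F j))"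
      if "k < 3" for k
    proof -
      have "(\<Sum>i<m. \<Sum>j<n. cnj (ces_entry m (\<lambda>l. of_bool (l = k)) i j) * (E i * F j)) =
        (\<Sum>i<m. \<Sum>j<4. cnj (ces_entry m (\<lambda>l. of_bool (l = k)) i j) * (E i * F j))"
        using mn that by (intro sum.cong refl sum.mono_neutral_right) (auto simp: ces_entry_def)
      also have "\<dots> = (\<Sum>i<3. \<Sum>j<4. cnj (ces_entry m (\<lambda>l. of_bool (l = k)) i j) * (E i * F j))"
        using mn that
        by (intro sum.mono_neutral_right) (auto simp: ces_entry_def intro!: sum.neutral)
      finally show ?thesis .
    qed
    have small: "(\<Sum>i<3. \<Sum>j<4. cnj (ces_entry m (\<lambda>l. of_bool (l = k)) i j) * (E i * F j)) = 0"
      if "k < 3" for k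
      using orth[of k] restrict[of k] that mn by simp
    have expand: "{..<3} = {0, 1, 2 :: nat}" "{..<4} = {0, 1, 2, 3 :: nat}" by auto
    \<comment> \<open>The coefficients of \<open>w 0\<close>, \<open>w 1\<close>, \<open>w 2\<close>
      in the bilinear form; the matrices are real, so \<open>cnj\<close> disappears.\<close>
    have eq: "E 0 * F 0 + E 2 * F 2 - E 1 * F 3 = 0" "E 0 * F 3 - E 2 * F 1 = 0"
      "E 1 * F 1 - E 0 * F 2 = 0"
      using small[of 0] small[of 1] small[of 2]
      by (simp_all add: ces_entry_def expand algebra_simps)
    \<comment> \<open>The substitution of \<open>E\<close> for \<open>w\<close>: the weights are
      \<open>E 0\<close>, \<open>E 1\<close>, \<open>E 2\<close>, and the determinant, now with a
      repeated argument, cancels.\<close>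
    have "E 0 * E 0 * F 0 = E 0 * (E 0 * F 0 + E 2 * F 2 - E 1 * F 3)
      + E 1 * (E 0 * F 3 - E 2 * F 1) + E 2 * (E 1 * F 1 - E 0 * F 2)"
      by (simp add: algebra_simps)
    then have "E 0 * E 0 * F 0 = 0" unfolding eq by simp
    then show "x \<in> H"
      by (auto simp: H_def x tensor_def conj_vec_def E_def F_def)
  qed
  moreover have "vec.subspace H" by (auto simp: H_def vec.subspace_def)
  ultimately have "vec.span (partial_conj_products V) \<subseteq> H" by (rule vec.span_minimal)
  moreover have "(\<chi> p. 1) \<notin> H" by (simp add: H_def)
  ultimately have "vec.span (partial_conj_products V) \<noteq> UNIV" by auto
  with CES dim supported show ?thesis by blast
qed

end
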